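(* Let $k\geq 2$ and let $A$ be a $(k+1)$-matrix with index set $V_1\times\cdots\times V_k\times V_{k+1}$, where $|V_i|=|V_j|$ for all $i,j$. For $1\leq i\leq k$ let $G_i$ be the bipartite graph with parts $V_{k+1}$ and $V_i$ in which $\{v_{k+1},v_i\}$ is an edge iff there is an index $v=(u_1,\ldots,u_{k+1})$ with $u_i=v_i$, $u_{k+1}=v_{k+1}$ and $A_v\neq 0$. If all $G_1,\ldots,G_k$ are planar, then $A$ is Kasteleyn.
   Context: Entries of the matrix lie in a commutative ring (e.g. polynomials). Each $V_i$ is linearly ordered, which identifies each bijection $\alpha:V_{k+1}\to V_i$ with a permutation and so defines $\mathrm{sign}(\alpha)$. For a $(k+1)$-matrix $M$ with index set $V_1\times\cdots\times V_{k+1}$: $\det(M)=\sum_{\alpha_1,\ldots,\alpha_k}\prod_{j=1}^k\mathrm{sign}(\alpha_j)\prod_{i\in V_{k+1}}M_{(\alpha_1(i),\ldots,\alpha_k(i),i)}$ and $\mathrm{per}(M)=\sum_{\alpha_1,\ldots,\alpha_k}\prod_{i\in V_{k+1}}M_{(\alpha_1(i),\ldots,\alpha_k(i),i)}$, the sums over all tuples of bijections $\alpha_j:V_{k+1}\to V_j$. A signing of $M$ is a matrix obtained from $M$ by multiplying some entries by $-1$. A matrix $A$ is Kasteleyn if there is a signing $A'$ of $A$ with $\mathrm{per}(A)=\det(A')$. *)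

theory Defs
  imports "HOL-Analysis.Analysis" "HOL-Combinatorics.Permutations" "HOL-Library.FuncSet"
begin

section \<open>Bijections between linearly ordered finite sets and their signs\<close>

text \<open>Functions are extensional (undefined outside their domain), so that
  distinct elements of this set really are distinct bijections.\<close>

definition bijections :: "'a set \<Rightarrow> 'b set \<Rightarrow> ('a \<Rightarrow> 'b) set" where
  "bijections X Y = {f \<in> X \<rightarrow>\<^sub>E Y. bij_betw f X Y}"

definition rank_in :: "'a::linorder set \<Rightarrow> 'a \<Rightarrow> nat" where
  "rank_in Y y = card {z \<in> Y. z < y}"

text \<open>With \<open>n = card X = card Y\<close>, the bijection \<open>f\<close> is transported along the increasing
  enumerations of \<open>X\<close> and \<open>Y\<close> to a permutation of \<open>{..<n}\<close>, continued by the identity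
  on the other natural numbers.\<close>

definition perm_of_bij :: "'a::linorder set \<Rightarrow> 'b::linorder set \<Rightarrow> ('a \<Rightarrow> 'b) \<Rightarrow> nat \<Rightarrow> nat" where
  "perm_of_bij X Y f =
     (\<lambda>r. if r < card X then rank_in Y (f (sorted_list_of_set X ! r)) else r)"

definition bij_sign :: "'a::linorder set \<Rightarrow> 'b::linorder set \<Rightarrow> ('a \<Rightarrow> 'b) \<Rightarrow> int" where
  "bij_sign X Y f = sign (perm_of_bij X Y f)"

section \<open>Multidimensional matrices\<close>

text \<open>A \<open>(k+1)\<close>-matrix with index set \<open>V 1 \<times> \<dots> \<times> V (k+1)\<close> is a function on index tuples,
  a tuple being an extensional function on \<open>{1..k+1}\<close>. Its values elsewhere are irrelevant.
  The sets \<open>V i\<close> live in one linearly ordered type but may overlap or coincide.\<close>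

definition indices :: "nat \<Rightarrow> (nat \<Rightarrow> 'a set) \<Rightarrow> (nat \<Rightarrow> 'a) set" where
  "indices k V = (\<Pi>\<^sub>E i\<in>{1..k+1}. V i)"

definition bij_tuples :: "nat \<Rightarrow> (nat \<Rightarrow> 'a set) \<Rightarrow> (nat \<Rightarrow> 'a \<Rightarrow> 'a) set" where
  "bij_tuples k V = (\<Pi>\<^sub>E j\<in>{1..k}. bijections (V (k+1)) (V j))"

text \<open>The index tuple \<open>(\<alpha>\<^sub>1(x), \<dots>, \<alpha>\<^sub>k(x), x)\<close>.\<close>

definition tuple_at :: "nat \<Rightarrow> (nat \<Rightarrow> 'a \<Rightarrow> 'a) \<Rightarrow> 'a \<Rightarrow> (nat \<Rightarrow> 'a)" where
  "tuple_at k \<alpha> x = (\<lambda>j\<in>{1..k+1}. if j = k+1 then x else \<alpha> j x)"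

definition mdet :: "nat \<Rightarrow> (nat \<Rightarrow> 'a::linorder set) \<Rightarrow> ((nat \<Rightarrow> 'a) \<Rightarrow> 'r::comm_ring_1) \<Rightarrow> 'r" where
  "mdet k V M = (\<Sum>\<alpha>\<in>bij_tuples k V.
     (\<Prod>j=1..k. of_int (bij_sign (V (k+1)) (V j) (\<alpha> j))) *
     (\<Prod>x\<in>V (k+1). M (tuple_at k \<alpha> x)))"

definition mper :: "nat \<Rightarrow> (nat \<Rightarrow> 'a set) \<Rightarrow> ((nat \<Rightarrow> 'a) \<Rightarrow> 'r::comm_ring_1) \<Rightarrow> 'r" where
  "mper k V M = (\<Sum>\<alpha>\<in>bij_tuples k V. \<Prod>x\<in>V (k+1). M (tuple_at k \<alpha> x))"

definition is_signing ::
    "nat \<Rightarrow> (nat \<Rightarrow> 'a set) \<Rightarrow> ((nat \<Rightarrow> 'a) \<Rightarrow> 'r::comm_ring_1) \<Rightarrow> ((nat \<Rightarrow> 'a) \<Rightarrow> 'r) \<Rightarrow> bool" where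
  "is_signing k V M M' \<longleftrightarrow> (\<forall>v\<in>indices k V. M' v = M v \<or> M' v = - M v)"

definition Kasteleyn ::
    "nat \<Rightarrow> (nat \<Rightarrow> 'a::linorder set) \<Rightarrow> ((nat \<Rightarrow> 'a) \<Rightarrow> 'r::comm_ring_1) \<Rightarrow> bool" where
  "Kasteleyn k V A \<longleftrightarrow> (\<exists>A'. is_signing k V A A' \<and> mper k V A = mdet k V A')"

section \<open>Planar graphs\<close>

text \<open>A simple graph is given by its vertex set and its set of two-element edges.
  A drawing in the plane maps vertices injectively to points by \<open>p\<close> and every edge \<open>e\<close> to an
  arc \<open>\<gamma> e\<close> joining the images of its ends; the interior of such an arc contains no
  vertex and no point of another edge.\<close>

definition plane_drawing ::
    "'v set \<Rightarrow> 'v set set \<Rightarrow> ('v \<Rightarrow> complex) \<Rightarrow> ('v set \<Rightarrow> real \<Rightarrow> complex) \<Rightarrow> bool" where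
  "plane_drawing W E p \<gamma> \<longleftrightarrow>
     inj_on p W \<and>
     (\<forall>e\<in>E. arc (\<gamma> e) \<and> {pathstart (\<gamma> e), pathfinish (\<gamma> e)} = p ` e \<and>
        (path_image (\<gamma> e) - p ` e) \<inter> p ` W = {}) \<and>
     (\<forall>e\<in>E. \<forall>f\<in>E. e \<noteq> f \<longrightarrow> (path_image (\<gamma> e) - p ` e) \<inter> path_image (\<gamma> f) = {})"

definition planar :: "'v set \<Rightarrow> 'v set set \<Rightarrow> bool" where
  "planar W E \<longleftrightarrow> (\<exists>p \<gamma>. plane_drawing W E p \<gamma>)"

text \<open>The bipartite graph \<open>G\<^sub>i\<close>. The parts are tagged by \<open>Inl\<close> and \<open>Inr\<close> because the sets
  \<open>V (k+1)\<close> and \<open>V i\<close> need not be disjoint.\<close>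

definition proj_vertices :: "nat \<Rightarrow> (nat \<Rightarrow> 'a set) \<Rightarrow> nat \<Rightarrow> ('a + 'a) set" where
  "proj_vertices k V i = Inl ` V (k+1) \<union> Inr ` V i"

definition proj_edges ::
    "nat \<Rightarrow> (nat \<Rightarrow> 'a set) \<Rightarrow> ((nat \<Rightarrow> 'a) \<Rightarrow> 'r::zero) \<Rightarrow> nat \<Rightarrow> ('a + 'a) set set" where
  "proj_edges k V A i =
     {{Inl x, Inr y} | x y. x \<in> V (k+1) \<and> y \<in> V i \<and>
        (\<exists>u\<in>indices k V. u i = y \<and> u (k+1) = x \<and> A u \<noteq> 0)}"

end

theory Submission
  imports Defs "HOL-Complex_Analysis.Complex_Analysis"
begin

text \<open>It suffices to find, for each planar \<open>G\<^sub>i\<close>, signs on its edges whose product over every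
  perfect matching \<open>\<alpha>\<close> is \<open>sign \<alpha>\<close>; the entries of \<open>A\<close> are then multiplied by the signs of
  their \<open>k\<close> projections. No faces or cycles are needed. For disjoint edges \<open>e, f\<close> of a plane
  drawing the point \<open>x - y\<close>, with \<open>x \<in> e\<close> and \<open>y \<in> f\<close>, never vanishes, so its argument has total
  change zero around the boundary of \<open>e \<times> f\<close>. Each side of this boundary is an edge paired with
  an end of the other. The argument change along a side, halved and compared with
  fixed square roots of the differences of vertices, yields a sign \<open>\<sigma>(e, v)\<close>, and the
  four signs multiply to \<open>-1\<close> exactly when \<open>e\<close> and \<open>f\<close> form an inversion. Since a perfect matching
  covers every vertex once, the product over all pairs of matching edges regroups into
  \<open>\<Prod>\<^sub>e s(e)\<close>, where \<open>s(e)\<close> is the product of \<open>\<sigma>(e, v)\<close> over all vertices \<open>v\<close> not on \<open>e\<close>.\<close>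

section \<open>Signs of bijections as products over inversions\<close>

definition ordered_pairs :: "'a::linorder set \<Rightarrow> ('a \<times> 'a) set" where
  "ordered_pairs X = {(x, y). x \<in> X \<and> y \<in> X \<and> x < y}"

text \<open>Comparing the two orders, rather than presupposing \<open>x < y\<close>, makes this
  symmetric for injective \<open>f\<close> and multiplicative under composition.\<close>

definition inversion_sign :: "('a::linorder \<Rightarrow> 'b::linorder) \<Rightarrow> 'a \<Rightarrow> 'a \<Rightarrow> int" where
  "inversion_sign f x y = (if (x < y) = (f x < f y) then 1 else - 1)"

lemma finite_ordered_pairs [intro]: "finite X \<Longrightarrow> finite (ordered_pairs X)"
  by (rule finite_subset[of _ "X \<times> X"]) (auto simp: ordered_pairs_def)

lemma inversion_sign_commute:
  assumes "inj_on f X" "x \<in> X" "y \<in> X"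
  shows "inversion_sign f x y = inversion_sign f y x"
  using assms unfolding inversion_sign_def inj_on_def
  by (metis less_asym linorder_neqE)

text \<open>A bijection carries unordered pairs to unordered pairs. Each is represented by its
  increasing version, so images are sorted by \<open>min\<close> and \<open>max\<close>; the
  symmetry of \<open>r\<close> makes the sorting harmless.\<close>

lemma prod_ordered_pairs_reindex:
  fixes f :: "'a::linorder \<Rightarrow> 'b::linorder" and r :: "'b \<Rightarrow> 'b \<Rightarrow> 'c::comm_monoid_mult"
  assumes f: "bij_betw f X Y" and sym: "\<And>x y. x \<in> Y \<Longrightarrow> y \<in> Y \<Longrightarrow> r x y = r y x"
  shows "(\<Prod>(x, y)\<in>ordered_pairs X. r (f x) (f y)) = (\<Prod>(x, y)\<in>ordered_pairs Y. r x y)"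
proof -
  define g where "g = inv_into X f"
  have g: "g (f x) = x" if "x \<in> X" for x
    using that f by (simp add: g_def bij_betw_inv_into_left)
  have fg: "f (g y) = y" "g y \<in> X" if "y \<in> Y" for y
    using that f by (auto simp: g_def bij_betw_inv_into_right intro: inv_into_into bij_betwE bij_betw_imp_surj_on)
      (metis bij_betw_imp_surj_on inv_into_into)
  have fY: "f x \<in> Y" if "x \<in> X" for x using f that by (auto dest: bij_betwE)
  let ?i = "\<lambda>h (x, y). (min (h x) (h y), max (h x) (h y))"
  show ?thesis
  proof (rule prod.reindex_bij_witness[of _ "?i g" "?i f"])
    fix a assume "a \<in> ordered_pairs X"
    then obtain x y where a: "a = (x, y)" and xy: "x \<in> X" "y \<in> X" "x < y"
      by (auto simp: ordered_pairs_def)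
    have ne: "f x \<noteq> f y" using xy g by (metis less_irrefl)
    show "?i g (?i f a) = a" using xy by (auto simp: a g min_def max_def)
    show "?i f a \<in> ordered_pairs Y" using ne xy fY by (auto simp: a ordered_pairs_def min_def max_def)
    show "(case ?i f a of (x, y) \<Rightarrow> r x y) = (case a of (x, y) \<Rightarrow> r (f x) (f y))"
      using xy fY by (auto simp: a min_def max_def sym)
  next
    fix b assume "b \<in> ordered_pairs Y"
    then obtain x y where b: "b = (x, y)" and xy: "x \<in> Y" "y \<in> Y" "x < y"
      by (auto simp: ordered_pairs_def)
    have ne: "g x \<noteq> g y" using xy fg by (metis less_irrefl)
    show "?i f (?i g b) = b" using xy by (auto simp: b fg min_def max_def)
    show "?i g b \<in> ordered_pairs X" using ne xy fg by (auto simp: b ordered_pairs_def min_def max_def)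
  qed
qed

text \<open>The inversions are \<open>(a, b)\<close> together with \<open>(a, z)\<close> and
  \<open>(z, b)\<close> for each \<open>z\<close> strictly between, an odd number in all.\<close>

lemma prod_ordered_pairs_transpose:
  fixes a b n :: nat
  assumes "a < b" "b < n"
  shows "(\<Prod>(x, y)\<in>ordered_pairs {..<n}. inversion_sign (Transposition.transpose a b) x y) = - 1"
proof -
  let ?t = "Transposition.transpose a b"
  let ?I = "{(a, b)} \<union> (Pair a ` {a<..<b} \<union> (\<lambda>z. (z, b)) ` {a<..<b})"
  have "(\<Prod>(x, y)\<in>ordered_pairs {..<n}. inversion_sign ?t x y)
      = (\<Prod>p\<in>ordered_pairs {..<n}. if p \<in> ?I then - 1 else 1)"
    using assms
    by (intro prod.cong refl) (auto simp: ordered_pairs_def inversion_sign_def Transposition.transpose_def split: if_splits)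
  also have "\<dots> = (\<Prod>p\<in>ordered_pairs {..<n} \<inter> ?I. - 1)"
    by (subst prod.inter_restrict[symmetric]) auto
  also have "ordered_pairs {..<n} \<inter> ?I = ?I"
    using assms by (auto simp: ordered_pairs_def)
  also have "(\<Prod>p\<in>?I. - 1 :: int) = (- 1) ^ card ?I" by simp
  also have "card ?I = 1 + card (Pair a ` {a<..<b} \<union> (\<lambda>z. (z, b)) ` {a<..<b})"
    by (subst card_Un_disjoint) auto
  also have "card (Pair a ` {a<..<b} \<union> (\<lambda>z. (z, b)) ` {a<..<b}) = 2 * card {a<..<b}"
    by (subst card_Un_disjoint) (auto simp: card_image inj_on_def)
  finally show ?thesis by simp
qed

text \<open>Induction over transpositions: reindexing along \<open>p\<close> splits off the product
  for the transposition, so both sides change sign at each step.\<close>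

lemma sign_eq_prod_inversion_sign:
  assumes "p permutes {..<n::nat}"
  shows "sign p = (\<Prod>(x, y)\<in>ordered_pairs {..<n}. inversion_sign p x y)"
  using assms finite_lessThan
proof (induction p rule: permutes_induct)
  case id
  then show ?case by (simp add: inversion_sign_def case_prod_unfold)
next
  case (swap a b p)
  let ?t = "Transposition.transpose a b"
  have t: "?t permutes {..<n}" using swap by (intro permutes_swap_id) auto
  have pq: "permutation p" "permutation ?t"
    using swap.hyps by (auto intro: permutes_imp_permutation permutation_swap_id)
  have bij: "bij_betw p {..<n} {..<n}" using swap.hyps by (simp add: permutes_imp_bij)
  have "(\<Prod>(x, y)\<in>ordered_pairs {..<n}. inversion_sign (?t \<circ> p) x y)
     = (\<Prod>(x, y)\<in>ordered_pairs {..<n}. inversion_sign ?t (p x) (p y) * inversion_sign p x y)"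
    by (intro prod.cong refl) (auto simp: inversion_sign_def)
  also have "\<dots> = (\<Prod>(x, y)\<in>ordered_pairs {..<n}. inversion_sign ?t (p x) (p y)) * sign p"
    by (simp add: swap.IH prod.distrib case_prod_unfold)
  also have "(\<Prod>(x, y)\<in>ordered_pairs {..<n}. inversion_sign ?t (p x) (p y))
     = (\<Prod>(x, y)\<in>ordered_pairs {..<n}. inversion_sign ?t x y)"
    using bij by (rule prod_ordered_pairs_reindex)
      (metis inversion_sign_commute permutes_inj_on t)
  also have "\<dots> = - 1"
  proof (cases "a < b")
    case True
    then show ?thesis using prod_ordered_pairs_transpose swap.hyps by simp
  next
    case False
    then have "b < a" using swap.hyps by simp
    then show ?thesis using prod_ordered_pairs_transpose[of b a n] swap.hyps
      by (simp add: transpose_commute)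
  qed
  also have "- 1 * sign p = sign (?t \<circ> p)"
    using pq swap.hyps by (simp add: sign_compose sign_swap_id)
  finally show ?case by (rule sym)
qed

lemma rank_in_less_iff:
  assumes "finite Y" "x \<in> Y" "y \<in> Y"
  shows "rank_in Y x < rank_in Y y \<longleftrightarrow> x < y"
proof -
  have *: "rank_in Y x < rank_in Y y" if "x < y" "x \<in> Y" for x y
    unfolding rank_in_def using assms(1) that by (intro psubset_card_mono) auto
  show ?thesis using *[of x y] *[of y x] assms by (cases x y rule: linorder_cases) auto
qed

lemma bij_betw_rank_in:
  assumes "finite Y"
  shows "bij_betw (rank_in Y) Y {..<card Y}"
proof -
  have inj: "inj_on (rank_in Y) Y"
    by (rule inj_onI) (metis assms less_irrefl linorder_neqE rank_in_less_iff)
  have "rank_in Y ` Y \<subseteq> {..<card Y}"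
    using assms by (auto simp: rank_in_def intro!: psubset_card_mono)
  then have "rank_in Y ` Y = {..<card Y}"
    by (intro card_subset_eq) (auto simp: card_image inj)
  with inj show ?thesis by (simp add: bij_betw_def)
qed

text \<open>The enumeration of \<open>X\<close> and the ranks in \<open>Y\<close> preserve order, so
  \<open>f\<close> and its transported permutation have corresponding inversions.\<close>

lemma bij_sign_eq_prod_inversion_sign:
  assumes fin: "finite X" "finite Y" and f: "bij_betw f X Y"
  shows "bij_sign X Y f = (\<Prod>(x, y)\<in>ordered_pairs X. inversion_sign f x y)"
proof -
  define n where "n = card X"
  have n: "card Y = n" using f by (simp add: n_def bij_betw_same_card)
  define e where "e = (\<lambda>r. sorted_list_of_set X ! r)"
  define p where "p = perm_of_bij X Y f"
  have e: "bij_betw e {..<n} X"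
    unfolding e_def using fin n_def by (intro bij_betw_nth) auto
  have e_less: "e i < e j \<longleftrightarrow> i < j" if "i < n" "j < n" for i j
  proof -
    have *: "e i < e j" if "i < j" "j < n" for i j
      using that strict_sorted_iff[of "sorted_list_of_set X"] fin
      by (simp add: e_def n_def sorted_wrt_nth_less)
    show ?thesis using *[of i j] *[of j i] that by (cases i j rule: linorder_cases) auto
  qed
  have peq: "p i = rank_in Y (f (e i))" if "i < n" for i
    using that by (simp add: p_def perm_of_bij_def e_def n_def)
  have "bij_betw (rank_in Y \<circ> (f \<circ> e)) {..<n} {..<n}"
    using bij_betw_rank_in[OF fin(2)] f e n by (intro bij_betw_trans) auto
  then have "bij_betw p {..<n} {..<n}"
    by (rule bij_betw_cong[THEN iffD1, rotated]) (simp add: peq)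
  then have perm: "p permutes {..<n}"
    by (rule bij_imp_permutes) (simp add: p_def perm_of_bij_def n_def)
  have mem: "f (e i) \<in> Y" if "i < n" for i
    using that e f by (auto dest!: bij_betwE)
  have "bij_sign X Y f = (\<Prod>(i, j)\<in>ordered_pairs {..<n}. inversion_sign p i j)"
    using sign_eq_prod_inversion_sign[OF perm] by (simp add: bij_sign_def p_def)
  also have "\<dots> = (\<Prod>(i, j)\<in>ordered_pairs {..<n}. inversion_sign f (e i) (e j))"
    using fin mem by (intro prod.cong refl)
      (auto simp: ordered_pairs_def inversion_sign_def peq rank_in_less_iff e_less)
  also have "\<dots> = (\<Prod>(x, y)\<in>ordered_pairs X. inversion_sign f x y)"
    using e by (rule prod_ordered_pairs_reindex)
      (metis bij_betw_imp_inj_on f inversion_sign_commute)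
  finally show ?thesis .
qed

text \<open>Each pair of distinct elements is increasing or the swap of an increasing one. This
  collects all factors with the same first element, the regrouping by matching edges.\<close>

lemma prod_ordered_pairs_symmetrize:
  fixes F :: "'a::linorder \<Rightarrow> 'a \<Rightarrow> 'c::comm_monoid_mult"
  assumes "finite X"
  shows "(\<Prod>(x, y)\<in>ordered_pairs X. F x y * F y x) = (\<Prod>x\<in>X. \<Prod>y\<in>X - {x}. F x y)"
proof -
  have "(\<Prod>x\<in>X. \<Prod>y\<in>X - {x}. F x y) = (\<Prod>(x, y)\<in>Sigma X (\<lambda>x. X - {x}). F x y)"
    using assms by (intro prod.Sigma) auto
  also have "Sigma X (\<lambda>x. X - {x}) = ordered_pairs X \<union> prod.swap ` ordered_pairs X"
    by (auto simp: ordered_pairs_def image_iff)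
  also have "(\<Prod>(x, y)\<in>\<dots>. F x y)
     = (\<Prod>(x, y)\<in>ordered_pairs X. F x y) * (\<Prod>(x, y)\<in>prod.swap ` ordered_pairs X. F x y)"
    using finite_ordered_pairs[OF assms]
    by (intro prod.union_disjoint finite_imageI) (auto simp: ordered_pairs_def)
  also have "(\<Prod>(x, y)\<in>prod.swap ` ordered_pairs X. F x y) = (\<Prod>(x, y)\<in>ordered_pairs X. F y x)"
    by (subst prod.reindex) (auto simp: inj_on_def case_prod_unfold)
  finally show ?thesis by (simp add: prod.distrib case_prod_unfold)
qed

section \<open>Winding numbers of disjoint paths\<close>

text \<open>Two continuous logarithms of \<open>p t - z\<close> differ by a continuous function
  whose values are at least \<open>2 * pi\<close> apart when distinct. That difference is constant,
  so both have the same total change, also along an open path.\<close>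

lemma winding_number_eq_log_diff:
  assumes p: "path p" and z: "z \<notin> path_image p" and L: "continuous_on {0..1} L"
    and pL: "\<And>t. t \<in> {0..1} \<Longrightarrow> p t - z = exp (L t)"
  shows "2 * of_real pi * \<i> * winding_number p z = L 1 - L 0"
proof -
  obtain q where q: "path q" "pathfinish q - pathstart q = 2 * of_real pi * \<i> * winding_number p z"
    and pq: "\<And>t. t \<in> {0..1} \<Longrightarrow> p t = z + exp (q t)"
    using winding_number_as_continuous_log[OF p z] by blast
  define D where "D t = q t - L t" for t
  have "D constant_on {0..1}"
  proof (rule continuous_discrete_range_constant)
    show "continuous_on {0..1} D"
      using q(1) L unfolding D_def path_def by (intro continuous_intros)
    have one: "exp (D t) = 1" if "t \<in> {0..1}" for t
      using pq[OF that] pL[OF that] by (simp add: D_def exp_diff)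
    show "\<exists>e>0. \<forall>y. y \<in> {0..1} \<and> D y \<noteq> D x \<longrightarrow> e \<le> norm (D y - D x)" if "x \<in> {0..1}" for x
    proof (intro exI[of _ "2*pi"] conjI allI impI)
      fix y assume y: "y \<in> {0..1} \<and> D y \<noteq> D x"
      then have "exp (D y - D x) = 1" using one[of y] one[OF that] by (simp add: exp_diff)
      then obtain k where k: "Re (D y - D x) = 0" "Im (D y - D x) = of_int (2 * k) * pi"
        unfolding exp_eq_1 by blast
      with y have "k \<noteq> 0" by (auto simp: complex_eq_iff)
      then have "1 \<le> \<bar>real_of_int k\<bar>" by linarith
      then have "2 * pi \<le> \<bar>Im (D y - D x)\<bar>" by (simp only: k) (simp add: abs_mult)
      also have "\<dots> \<le> norm (D y - D x)" by (rule abs_Im_le_cmod)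
      finally show "2 * pi \<le> norm (D y - D x)" .
    qed simp
  qed simp
  then have "D 1 = D 0" by (auto simp: constant_on_def)
  with q(2) show ?thesis by (simp add: D_def pathfinish_def pathstart_def algebra_simps)
qed

text \<open>The map \<open>(s, t) \<mapsto> g s - h t\<close> avoids \<open>0\<close> on the unit square, so it has a logarithm there,
  whose total change along the boundary of the square vanishes.\<close>

lemma winding_number_disjoint_paths:
  assumes g: "path g" and h: "path h" and disj: "path_image g \<inter> path_image h = {}"
  shows "winding_number g (pathstart h) + winding_number h (pathfinish g)
       = winding_number g (pathfinish h) + winding_number h (pathstart g)"
proof -
  let ?Q = "{0..1::real} \<times> {0..1::real}"
  have ne: "g s \<noteq> h t" if "s \<in> {0..1}" "t \<in> {0..1}" for s t
    using disj that unfolding path_image_def by blast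
  have cg: "continuous_on {0..1} g" and ch: "continuous_on {0..1} h"
    using g h by (auto simp: path_def)
  have "continuous_on ?Q (\<lambda>z. g (fst z) - h (snd z))"
    by (intro continuous_intros continuous_on_compose2[OF cg] continuous_on_compose2[OF ch]) auto
  moreover have "contractible ?Q"
    by (intro convex_imp_contractible convex_Times) auto
  moreover have "g (fst z) - h (snd z) \<noteq> 0" if "z \<in> ?Q" for z
    using ne that by auto
  ultimately obtain L where L: "continuous_on ?Q L"
    and eL: "\<And>z. z \<in> ?Q \<Longrightarrow> g (fst z) - h (snd z) = exp (L z)"
    using continuous_logarithm_on_contractible by blast
  have cL1: "continuous_on {0..1} (\<lambda>s. L (s, t))" if "t \<in> {0..1}" for t
    using that by (intro continuous_on_compose2[OF L] continuous_intros) auto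
  \<comment> \<open>The shift by \<open>\<i> * pi\<close> turns a logarithm of
    \<open>g s - h t\<close> into one of \<open>h t - g s\<close>; it cancels in
    differences.\<close>
  have cL2: "continuous_on {0..1} (\<lambda>t. L (s, t) + \<i> * pi)" if "s \<in> {0..1}" for s
    using that by (intro continuous_intros continuous_on_compose2[OF L]) auto
  have A: "2 * of_real pi * \<i> * winding_number g (h t) = L (1, t) - L (0, t)" if t: "t \<in> {0..1}" for t
  proof -
    have "g s - h t = exp (L (s, t))" if "s \<in> {0..1}" for s
      using eL[of "(s, t)"] t that by simp
    moreover have "h t \<notin> path_image g" using ne[OF _ t] unfolding path_image_def by (metis imageE)
    ultimately show ?thesis by (intro winding_number_eq_log_diff[OF g _ cL1[OF t]])
  qed
  have B: "2 * of_real pi * \<i> * winding_number h (g s) = L (s, 1) - L (s, 0)" if s: "s \<in> {0..1}" for s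
  proof -
    have "h t - g s = exp (L (s, t) + \<i> * pi)" if "t \<in> {0..1}" for t
    proof -
      have "exp (L (s, t)) = g s - h t" using eL[of "(s, t)"] s that by simp
      then show ?thesis by (simp add: exp_add)
    qed
    moreover have "g s \<notin> path_image h" using ne[OF s] unfolding path_image_def by (metis imageE)
    ultimately have "2 * of_real pi * \<i> * winding_number h (g s) = (L (s, 1) + \<i> * pi) - (L (s, 0) + \<i> * pi)"
      by (intro winding_number_eq_log_diff[OF h _ cL2[OF s]])
    then show ?thesis by simp
  qed
  \<comment> \<open>Both sides are \<open>L (1, 1) - L (0, 0)\<close>, computed along the two ways
    around the square.\<close>
  have "2 * of_real pi * \<i> * (winding_number g (h 0) + winding_number h (g 1))
      = 2 * of_real pi * \<i> * (winding_number g (h 1) + winding_number h (g 0))"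
    unfolding distrib_left by (simp add: A B)
  then show ?thesis by (simp add: pathstart_def pathfinish_def)
qed

section \<open>Disjoint edges of a plane drawing and their phases at vertices\<close>

lemma plane_drawing_vertex_notin_path:
  assumes "plane_drawing W E p \<gamma>" "e \<in> E" "e \<subseteq> W" "v \<in> W" "v \<notin> e"
  shows "p v \<notin> path_image (\<gamma> e)"
proof
  assume v: "p v \<in> path_image (\<gamma> e)"
  have "p v \<notin> p ` e"
    using assms inj_on_image_mem_iff unfolding plane_drawing_def by metis
  with v assms show False unfolding plane_drawing_def by blast
qed

text \<open>The drawing keeps the interior of the arc of \<open>e\<close> off the arc of
  \<open>f\<close>; the ends of \<open>e\<close> are vertices outside \<open>f\<close>. Nonemptiness
  of \<open>e\<close> ensures \<open>e \<noteq> f\<close>.\<close>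

lemma plane_drawing_disjoint_edges:
  assumes d: "plane_drawing W E p \<gamma>" and e: "e \<in> E" "e \<subseteq> W" and f: "f \<in> E" "f \<subseteq> W"
    and ef: "e \<inter> f = {}" "e \<noteq> {}"
  shows "path_image (\<gamma> e) \<inter> path_image (\<gamma> f) = {}"
proof -
  have "(path_image (\<gamma> e) - p ` e) \<inter> path_image (\<gamma> f) = {}"
    using d e f ef unfolding plane_drawing_def by (metis Int_absorb)
  moreover have "p v \<notin> path_image (\<gamma> f)" if "v \<in> e" for v
    using plane_drawing_vertex_notin_path[OF d f] that e ef by blast
  ultimately show ?thesis by blast
qed

text \<open>A square root of \<open>p u - p v\<close> for every ordered pair of distinct vertices. Exchanging \<open>u\<close>
  and \<open>v\<close> multiplies it by \<open>\<plusminus>\<i>\<close>, and the sign records the order of the two vertices.\<close>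

fun vertex_root :: "('a::linorder + 'b::linorder \<Rightarrow> complex) \<Rightarrow> 'a + 'b \<Rightarrow> 'a + 'b \<Rightarrow> complex" where
  "vertex_root p (Inl x) (Inr y) = \<i> * csqrt (p (Inr y) - p (Inl x))"
| "vertex_root p (Inr y) (Inl x) = csqrt (p (Inr y) - p (Inl x))"
| "vertex_root p (Inl x) (Inl x') =
     (if x < x' then - \<i> * csqrt (p (Inl x') - p (Inl x)) else csqrt (p (Inl x) - p (Inl x')))"
| "vertex_root p (Inr y) (Inr y') =
     (if y < y' then \<i> * csqrt (p (Inr y') - p (Inr y)) else csqrt (p (Inr y) - p (Inr y')))"

lemma vertex_root_square: "(vertex_root p u v)\<^sup>2 = p u - p v"
  by (cases "(p, u, v)" rule: vertex_root.cases) (auto simp: power_mult_distrib)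

text \<open>Continuing the square root \<open>vertex_root p a v\<close> along \<open>g\<close>
  multiplies it by the exponential; the quotient compares the result with the root fixed at
  \<open>b\<close>.\<close>

definition edge_vertex_phase ::
    "('a::linorder + 'b::linorder \<Rightarrow> complex) \<Rightarrow> (real \<Rightarrow> complex) \<Rightarrow> 'a + 'b \<Rightarrow> 'a + 'b \<Rightarrow> 'a + 'b \<Rightarrow> complex" where
  "edge_vertex_phase p g a b v =
     exp (of_real pi * \<i> * winding_number g (p v)) * vertex_root p a v / vertex_root p b v"

text \<open>The continued root and the fixed root are both square roots of
  \<open>p b - p v\<close>.\<close>

lemma edge_vertex_phase_cases:
  assumes g: "path g" "pathstart g = p a" "pathfinish g = p b" and v: "p v \<notin> path_image g"
  shows "edge_vertex_phase p g a b v = 1 \<or> edge_vertex_phase p g a b v = - 1"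
proof -
  have "p b \<noteq> p v" using v g pathfinish_in_path_image by metis
  have "(exp (of_real pi * \<i> * winding_number g (p v)))\<^sup>2 = exp (2 * pi * \<i> * winding_number g (p v))"
    by (simp flip: exp_double add: algebra_simps)
  then have "(edge_vertex_phase p g a b v)\<^sup>2 = (p b - p v) / (p b - p v)"
    using winding_number_exp_2pi[OF g(1) v] g
    by (simp add: edge_vertex_phase_def power_mult_distrib power_divide vertex_root_square)
  then have "(edge_vertex_phase p g a b v)\<^sup>2 = 1" using \<open>p b \<noteq> p v\<close> by simp
  then show ?thesis by (simp add: power2_eq_1_iff)
qed

lemma edge_vertex_phase_product:
  fixes p :: "'a::linorder + 'b::linorder \<Rightarrow> complex"
  assumes g: "path g" "pathstart g = p (Inl a)" "pathfinish g = p (Inr b)"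
    and h: "path h" "pathstart h = p (Inl c)" "pathfinish h = p (Inr d)"
    and disj: "path_image g \<inter> path_image h = {}"
    and ac: "a \<noteq> c" and bd: "b \<noteq> d"
    and inj: "p (Inl a) \<noteq> p (Inl c)" "p (Inr b) \<noteq> p (Inr d)"
  shows "edge_vertex_phase p g (Inl a) (Inr b) (Inl c) * edge_vertex_phase p g (Inl a) (Inr b) (Inr d)
       * edge_vertex_phase p h (Inl c) (Inr d) (Inl a) * edge_vertex_phase p h (Inl c) (Inr d) (Inr b)
       = (if (a < c) = (b < d) then 1 else - 1)"
proof -
  let ?E = "\<lambda>g v. exp (of_real pi * \<i> * winding_number g (p v))"
  let ?r = "vertex_root p"
  have mem: "p (Inl a) \<in> path_image g" "p (Inr b) \<in> path_image g"
    "p (Inl c) \<in> path_image h" "p (Inr d) \<in> path_image h"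
    using g h pathstart_in_path_image pathfinish_in_path_image by metis+
  have ne: "p (Inl a) \<noteq> p (Inr d)" "p (Inl c) \<noteq> p (Inr b)"
    using mem disj by auto
  have E: "?E g (Inl c) * ?E h (Inr b) = ?E g (Inr d) * ?E h (Inl a)"
    using winding_number_disjoint_paths[OF g(1) h(1) disj] g h
    by (simp flip: exp_add distrib_left)
  have inv: "1 / z = z" if "z = 1 \<or> z = - 1" for z :: complex
    using that by auto
  \<comment> \<open>A sign is its own inverse. Inverting these two phases places their exponentials
    in the denominator, where \<open>E\<close> cancels all four and leaves only ratios of opposite
    roots.\<close>
  have "edge_vertex_phase p g (Inl a) (Inr b) (Inr d) = 1 / edge_vertex_phase p g (Inl a) (Inr b) (Inr d)"
    using edge_vertex_phase_cases[OF g] mem disj by (intro inv[symmetric]) blast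
  moreover have "edge_vertex_phase p h (Inl c) (Inr d) (Inl a) = 1 / edge_vertex_phase p h (Inl c) (Inr d) (Inl a)"
    using edge_vertex_phase_cases[OF h] mem disj by (intro inv[symmetric]) blast
  ultimately have "edge_vertex_phase p g (Inl a) (Inr b) (Inl c) * edge_vertex_phase p g (Inl a) (Inr b) (Inr d)
       * edge_vertex_phase p h (Inl c) (Inr d) (Inl a) * edge_vertex_phase p h (Inl c) (Inr d) (Inr b)
     = edge_vertex_phase p g (Inl a) (Inr b) (Inl c) * (1 / edge_vertex_phase p g (Inl a) (Inr b) (Inr d))
       * (1 / edge_vertex_phase p h (Inl c) (Inr d) (Inl a)) * edge_vertex_phase p h (Inl c) (Inr d) (Inr b)"
    by simp
  also have "\<dots> = (?E g (Inl c) * ?E h (Inr b)) / (?E g (Inr d) * ?E h (Inl a))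
       * ((?r (Inl a) (Inl c) / ?r (Inl c) (Inl a)) * (?r (Inr b) (Inr d) / ?r (Inr d) (Inr b))
       * (?r (Inl c) (Inr b) / ?r (Inr b) (Inl c)) * (?r (Inr d) (Inl a) / ?r (Inl a) (Inr d)))"
    by (simp add: edge_vertex_phase_def mult_ac del: vertex_root.simps)
  also have "\<dots> = (?r (Inl a) (Inl c) / ?r (Inl c) (Inl a)) * (?r (Inr b) (Inr d) / ?r (Inr d) (Inr b))
       * (?r (Inl c) (Inr b) / ?r (Inr b) (Inl c)) * (?r (Inr d) (Inl a) / ?r (Inl a) (Inr d))"
    unfolding E by (simp del: vertex_root.simps)
  also have "?r (Inl c) (Inr b) / ?r (Inr b) (Inl c) = \<i>" using ne by simp
  also have "?r (Inr d) (Inl a) / ?r (Inl a) (Inr d) = - \<i>" using ne by simp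
  \<comment> \<open>The two parts have opposite conventions in \<open>vertex_root\<close>, so that
    the product with the mixed ratios \<open>\<i>\<close> and \<open>- \<i>\<close> is
    \<open>1\<close> exactly when the orders agree.\<close>
  also have "?r (Inl a) (Inl c) / ?r (Inl c) (Inl a) = (if a < c then - \<i> else \<i>)"
    using inj(1) ac by (auto simp: field_simps)
  also have "?r (Inr b) (Inr d) / ?r (Inr d) (Inr b) = (if b < d then \<i> else - \<i>)"
    using inj(2) bd by (auto simp: field_simps)
  also have "(if a < c then - \<i> else \<i>) * (if b < d then \<i> else - \<i>) * \<i> * (- \<i>)
      = (if (a < c) = (b < d) then 1 else - 1)"
    by auto
  finally show ?thesis .
qed

section \<open>Edge signs for a planar bipartite graph\<close>

lemma planar_bipartite_signing:
  fixes X :: "'a::linorder set" and Y :: "'b::linorder set"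
  assumes fin: "finite X" "finite Y" and R: "R \<subseteq> X \<times> Y"
    and planar: "planar (Inl ` X \<union> Inr ` Y) {{Inl x, Inr y} | x y. (x, y) \<in> R}"
  obtains s :: "'a \<Rightarrow> 'b \<Rightarrow> int" where "\<And>x y. s x y = 1 \<or> s x y = - 1"
    and "\<And>f. bij_betw f X Y \<Longrightarrow> (\<And>x. x \<in> X \<Longrightarrow> (x, f x) \<in> R) \<Longrightarrow>
           bij_sign X Y f = (\<Prod>x\<in>X. s x (f x))"
proof -
  define W :: "('a + 'b) set" where "W = Inl ` X \<union> Inr ` Y"
  define E :: "('a + 'b) set set" where "E = {{Inl x, Inr y} | x y. (x, y) \<in> R}"
  obtain p \<gamma> where d: "plane_drawing W E p \<gamma>"
    using planar unfolding planar_def W_def E_def by blast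
  have inj: "inj_on p W" using d by (simp add: plane_drawing_def)
  have E: "{Inl x, Inr y} \<in> E" "{Inl x, Inr y} \<subseteq> W" if "(x, y) \<in> R" for x y
    using that R by (auto simp: E_def W_def)
  \<comment> \<open>A drawing prescribes only the unordered pair of ends of an arc; \<open>G\<close>
    orients every edge from \<open>X\<close> to \<open>Y\<close>.\<close>
  define G where "G x y = (if pathstart (\<gamma> {Inl x, Inr y}) = p (Inl x)
      then \<gamma> {Inl x, Inr y} else reversepath (\<gamma> {Inl x, Inr y}))" for x y
  have Gimage: "path_image (G x y) = path_image (\<gamma> {Inl x, Inr y})" for x y
    by (simp add: G_def)
  have G: "path (G x y)" "pathstart (G x y) = p (Inl x)" "pathfinish (G x y) = p (Inr y)"
    if "(x, y) \<in> R" for x y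
  proof -
    have "arc (\<gamma> {Inl x, Inr y})"
      "{pathstart (\<gamma> {Inl x, Inr y}), pathfinish (\<gamma> {Inl x, Inr y})} = {p (Inl x), p (Inr y)}"
      using d E[OF that] unfolding plane_drawing_def by auto
    then show "path (G x y)" "pathstart (G x y) = p (Inl x)" "pathfinish (G x y) = p (Inr y)"
      by (auto simp: G_def arc_imp_path doubleton_eq_iff)
  qed
  define c where "c x y v = edge_vertex_phase p (G x y) (Inl x) (Inr y) v" for x y v
  \<comment> \<open>The default \<open>- 1\<close> keeps \<open>t\<close> a sign off the edges too,
    where \<open>c\<close> is not known to be one, so \<open>s\<close> is a sign everywhere.\<close>
  define t :: "'a \<Rightarrow> 'b \<Rightarrow> 'a + 'b \<Rightarrow> int" where "t x y v = (if c x y v = 1 then 1 else - 1)" for x y v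
  define s where "s x y = (\<Prod>x'\<in>X - {x}. t x y (Inl x')) * (\<Prod>y'\<in>Y - {y}. t x y (Inr y'))" for x y
  have tc: "of_int (t x y v) = c x y v" if "(x, y) \<in> R" "v \<in> W" "v \<noteq> Inl x" "v \<noteq> Inr y" for x y v
  proof -
    have "p v \<notin> path_image (G x y)"
      unfolding Gimage using that E by (intro plane_drawing_vertex_notin_path[OF d]) auto
    from edge_vertex_phase_cases[OF G[OF that(1)] this] show ?thesis
      by (auto simp: t_def c_def)
  qed
  show ?thesis
  proof
    show "s x y = 1 \<or> s x y = - 1" for x y
    proof -
      have "\<bar>s x y\<bar> = 1" by (simp add: s_def abs_mult abs_prod t_def if_distrib cong: if_cong)
      then show ?thesis by linarith
    qed
    fix f assume f: "bij_betw f X Y" and fR: "\<And>x. x \<in> X \<Longrightarrow> (x, f x) \<in> R"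
    \<comment> \<open>\<open>F x x'\<close> gathers the signs of the matching edge at
      \<open>x\<close> at both ends of the matching edge at \<open>x'\<close>.\<close>
    define F where "F x x' = t x (f x) (Inl x') * t x (f x) (Inr (f x'))" for x x'
    have "inversion_sign f x y = F x y * F y x" if xy: "x \<in> X" "y \<in> X" "x \<noteq> y" for x y
    proof -
      have fY: "f x \<in> Y" "f y \<in> Y" "f x \<noteq> f y"
        using f xy by (auto dest: bij_betwE simp: bij_betw_def inj_on_def)
      have W: "Inl x \<in> W" "Inl y \<in> W" "Inr (f x) \<in> W" "Inr (f y) \<in> W"
        using xy fY by (auto simp: W_def)
      have pne: "p (Inl x) \<noteq> p (Inl y)" "p (Inr (f x)) \<noteq> p (Inr (f y))"
        using inj W xy fY by (auto simp: inj_on_eq_iff)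
      have disj: "path_image (G x (f x)) \<inter> path_image (G y (f y)) = {}"
        unfolding Gimage using E[OF fR[OF xy(1)]] E[OF fR[OF xy(2)]] xy fY
        by (intro plane_drawing_disjoint_edges[OF d]) auto
      have "complex_of_int (F x y * F y x) = of_int (inversion_sign f x y)"
        using edge_vertex_phase_product[OF G[OF fR[OF xy(1)]] G[OF fR[OF xy(2)]] disj xy(3) fY(3) pne]
          W fR[OF xy(1)] fR[OF xy(2)] xy fY
        by (simp add: F_def tc c_def inversion_sign_def mult.assoc)
      then show ?thesis by (simp only: of_int_eq_iff)
    qed
    then have "bij_sign X Y f = (\<Prod>(x, y)\<in>ordered_pairs X. F x y * F y x)"
      unfolding bij_sign_eq_prod_inversion_sign[OF fin f]
      by (intro prod.cong refl) (auto simp: ordered_pairs_def)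
    also have "\<dots> = (\<Prod>x\<in>X. \<Prod>y\<in>X - {x}. F x y)"
      by (rule prod_ordered_pairs_symmetrize[OF fin(1)])
    also have "\<dots> = (\<Prod>x\<in>X. s x (f x))"
    proof (rule prod.cong[OF refl])
      fix x assume x: "x \<in> X"
      \<comment> \<open>The partners of the other elements fill \<open>Y - {f x}\<close>, so the
        product depends on \<open>f\<close> only through the edge \<open>(x, f x)\<close>.\<close>
      have "bij_betw f (X - {x}) (Y - {f x})"
        using f x by (auto simp: bij_betw_def inj_on_def)
      then have "(\<Prod>y\<in>X - {x}. t x (f x) (Inr (f y))) = (\<Prod>y\<in>Y - {f x}. t x (f x) (Inr y))"
        by (rule prod.reindex_bij_betw)
      then show "(\<Prod>y\<in>X - {x}. F x y) = s x (f x)"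
        by (simp add: F_def s_def prod.distrib)
    qed
    finally show "bij_sign X Y f = (\<Prod>x\<in>X. s x (f x))" .
  qed
qed

section \<open>From edge signs of the projections to a signing of the matrix\<close>

theorem theorem2p9:
  fixes k :: nat
    and V :: "nat \<Rightarrow> 'a::linorder set"
    and A :: "(nat \<Rightarrow> 'a) \<Rightarrow> 'r::comm_ring_1"
  assumes "k \<ge> 2"
    and "\<And>i. i \<in> {1..k+1} \<Longrightarrow> finite (V i)"
    and "\<And>i j. i \<in> {1..k+1} \<Longrightarrow> j \<in> {1..k+1} \<Longrightarrow> card (V i) = card (V j)"
    and "\<And>i. i \<in> {1..k} \<Longrightarrow> planar (proj_vertices k V i) (proj_edges k V A i)"
  shows "Kasteleyn k V A"
proof -
  define X where "X = V (k+1)"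
  define R where "R j = {(x, y). x \<in> X \<and> y \<in> V j \<and>
    (\<exists>u\<in>indices k V. u j = y \<and> u (k+1) = x \<and> A u \<noteq> 0)}" for j
  define P where "P j s \<longleftrightarrow> (\<forall>x y. s x y = (1::int) \<or> s x y = - 1) \<and>
      (\<forall>f. bij_betw f X (V j) \<longrightarrow> (\<forall>x\<in>X. (x, f x) \<in> R j) \<longrightarrow>
        bij_sign X (V j) f = (\<Prod>x\<in>X. s x (f x)))" for j s
  have "\<exists>s. P j s" if j: "j \<in> {1..k}" for j
  proof -
    have "finite X" "finite (V j)" using assms(2) j by (auto simp: X_def)
    moreover have "R j \<subseteq> X \<times> V j" by (auto simp: R_def)
    moreover have "planar (Inl ` X \<union> Inr ` V j) {{Inl x, Inr y} | x y. (x, y) \<in> R j}"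
      using assms(4)[OF j] by (simp add: proj_vertices_def proj_edges_def R_def X_def)
    ultimately show ?thesis unfolding P_def by (rule planar_bipartite_signing) blast
  qed
  then obtain s where s: "\<And>j. j \<in> {1..k} \<Longrightarrow> P j (s j)" by metis
  have s1: "s j x y = 1 \<or> s j x y = - 1" if "j \<in> {1..k}" for j x y
    using s[OF that] unfolding P_def by blast
  have s2: "bij_sign X (V j) f = (\<Prod>x\<in>X. s j x (f x))"
    if "j \<in> {1..k}" "bij_betw f X (V j)" "\<And>x. x \<in> X \<Longrightarrow> (x, f x) \<in> R j" for j f
    using s[OF that(1)] that(2,3) unfolding P_def by blast
  define S where "S v = (\<Prod>j=1..k. s j (v (k+1)) (v j))" for v
  define A' where "A' v = of_int (S v) * A v" for v
  have "\<bar>S v\<bar> = 1" for v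
    unfolding S_def abs_prod using s1 by (intro prod.neutral ballI) (metis abs_1 abs_minus_cancel)
  then have S: "S v = 1 \<or> S v = - 1" for v by (metis abs_eq_iff abs_one)
  have "is_signing k V A A'"
    unfolding is_signing_def A'_def using S by (metis mult_1 mult_minus1 of_int_1 of_int_minus)
  moreover have "mper k V A = mdet k V A'"
    unfolding mper_def mdet_def X_def[symmetric]
  proof (rule sum.cong[OF refl])
    fix \<alpha> assume \<alpha>: "\<alpha> \<in> bij_tuples k V"
    have bij: "bij_betw (\<alpha> j) X (V j)" if "j \<in> {1..k}" for j
      using \<alpha> that by (auto simp: bij_tuples_def bijections_def X_def PiE_iff)
    have tup: "tuple_at k \<alpha> x (k+1) = x" "j \<in> {1..k} \<Longrightarrow> tuple_at k \<alpha> x j = \<alpha> j x" for x j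
      by (auto simp: tuple_at_def)
    have ind: "tuple_at k \<alpha> x \<in> indices k V" if "x \<in> X" for x
      using that bij_betw_apply[OF bij] by (auto simp: tuple_at_def indices_def X_def)
    show "(\<Prod>x\<in>X. A (tuple_at k \<alpha> x)) =
      (\<Prod>j=1..k. of_int (bij_sign X (V j) (\<alpha> j))) * (\<Prod>x\<in>X. A' (tuple_at k \<alpha> x))"
    \<comment> \<open>If no entry along \<open>\<alpha>\<close> vanishes, these entries witness that
      every \<open>\<alpha> j\<close> is a perfect matching of its projection graph. Otherwise both
      products are zero.\<close>
    proof (cases "\<forall>x\<in>X. A (tuple_at k \<alpha> x) \<noteq> 0")
      case True
      have sgn: "bij_sign X (V j) (\<alpha> j) = (\<Prod>x\<in>X. s j x (\<alpha> j x))" if j: "j \<in> {1..k}" for j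
      proof (rule s2[OF j bij[OF j]])
        show "(x, \<alpha> j x) \<in> R j" if "x \<in> X" for x
          unfolding R_def
          using that True ind[OF that] tup(1)[of x] tup(2)[OF j, of x] bij_betw_apply[OF bij[OF j] that]
          by blast
      qed
      have "(\<Prod>j=1..k. bij_sign X (V j) (\<alpha> j)) = (\<Prod>j=1..k. \<Prod>x\<in>X. s j x (\<alpha> j x))"
        by (intro prod.cong refl sgn)
      also have "\<dots> = (\<Prod>x\<in>X. \<Prod>j=1..k. s j x (\<alpha> j x))" by (rule prod.swap)
      also have "\<dots> = (\<Prod>x\<in>X. S (tuple_at k \<alpha> x))"
        unfolding S_def by (intro prod.cong refl) (simp add: tup del: One_nat_def)
      \<comment> \<open>The product of the \<open>k\<close> bijection signs equals the product of
        the entry signs, and each entry sign squares to \<open>1\<close>.\<close>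
      finally have "(\<Prod>j=1..k. bij_sign X (V j) (\<alpha> j)) * (\<Prod>x\<in>X. S (tuple_at k \<alpha> x)) =
          (\<Prod>x\<in>X. S (tuple_at k \<alpha> x) * S (tuple_at k \<alpha> x))"
        by (simp add: prod.distrib)
      also have "\<dots> = 1"
        using S by (intro prod.neutral) (metis mult_1 mult_minus1 minus_minus)
      finally have "(of_int ((\<Prod>j=1..k. bij_sign X (V j) (\<alpha> j)) * (\<Prod>x\<in>X. S (tuple_at k \<alpha> x))) :: 'r) = 1"
        by simp
      then show ?thesis
        by (simp add: A'_def prod.distrib flip: mult.assoc del: One_nat_def)
    next
      case False
      then obtain x where "x \<in> X" "A (tuple_at k \<alpha> x) = 0" by blast
      moreover have "finite X" using assms(2) by (simp add: X_def)
      ultimately have "(\<Prod>x\<in>X. A (tuple_at k \<alpha> x)) = 0" "(\<Prod>x\<in>X. A' (tuple_at k \<alpha> x)) = 0"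
        unfolding A'_def by (metis (no_types, lifting) prod_zero mult_zero_right)+
      then show ?thesis by simp
    qed
  qed
  ultimately show ?thesis unfolding Kasteleyn_def by blast
qed

end
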